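(* If $X$ is a uniformly locally pathwise connected, connected and simply connected uniform space, then $X$ is universal.
   Context: All entourages are taken to be symmetric; $B(x,E)=\{y:(x,y)\in E\}$ is the $E$-ball at $x$. $X$ is uniformly locally pathwise connected if for each entourage $E$ there is an entourage $F\subset E$ such that all $F$-balls are open and pathwise connected. $X$ is simply connected if every loop in $X$ is null-homotopic. Fix a basepoint $*\in X$. For an entourage $E$ of $X$, an $E$-chain from $p$ to $q$ is a finite sequence $\{x_0=p,\dots,x_n=q\}$ with $(x_i,x_{i+1})\in E$ for all $i$. Two $E$-chains with the same endpoints are $E$-homotopic if one is obtained from the other in finitely many steps, each adding or removing a single point, always keeping the endpoints fixed and keeping an $E$-chain at each stage (in particular $\{p\}$ and $\{p,p\}$ are $E$-homotopic); $[\alpha]_E$ is the class of $\alpha$. $X_E$ is the set of $E$-homotopy classes of $E$-chains starting at $*$. For an entourage $D\subset E$ let $D^*$ be the set of pairs $([*=x_0,\dots,x_n,y]_E,[*=x_0,\dots,x_n,z]_E)$ with $(y,z)\in D$; $X_E$ carries the uniformity with base $\{D^*:D\subset E\}$. The endpoint map is $\phi_{XE}:X_E\to X$. $X$ is universal if its uniformity has a base $\mathcal{U}$ such that for every $E\in\mathcal{U}$ the map $\phi_{XE}:X_E\to X$ is a uniform homeomorphism. *)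

theory Defs
  imports "HOL-Analysis.Analysis"
begin

section \<open>Entourages\<close>

text \<open>Entourages are symmetric by convention. The symmetric members of the uniformity filter form a
  base of it.\<close>

definition entourage :: "('a::uniform_space \<times> 'a) set \<Rightarrow> bool" where
  "entourage E \<longleftrightarrow> sym E \<and> eventually (\<lambda>p. p \<in> E) uniformity"

definition entourage_base :: "('a::uniform_space \<times> 'a) set set \<Rightarrow> bool" where
  "entourage_base \<U> \<longleftrightarrow>
     (\<forall>E\<in>\<U>. entourage E) \<and> (\<forall>E. entourage E \<longrightarrow> (\<exists>F\<in>\<U>. F \<subseteq> E))"

definition eball :: "'a \<Rightarrow> ('a \<times> 'a) set \<Rightarrow> 'a set" where
  "eball x E = {y. (x, y) \<in> E}"

definition uniformly_locally_path_connected :: "'a::uniform_space itself \<Rightarrow> bool" where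
  "uniformly_locally_path_connected _ \<longleftrightarrow>
     (\<forall>E::('a \<times> 'a) set. entourage E \<longrightarrow>
        (\<exists>F. entourage F \<and> F \<subseteq> E \<and> (\<forall>x. open (eball x F) \<and> path_connected (eball x F))))"

text \<open>Unlike the library's \<open>simply_connected\<close>, this does not include path connectedness.\<close>

definition loops_null_homotopic :: "'a::topological_space itself \<Rightarrow> bool" where
  "loops_null_homotopic _ \<longleftrightarrow>
     (\<forall>g :: real \<Rightarrow> 'a. path g \<and> pathfinish g = pathstart g \<longrightarrow>
        homotopic_paths UNIV g (\<lambda>_. pathstart g))"


section \<open>Chains and their homotopy classes\<close>

definition chain :: "('a \<times> 'a) set \<Rightarrow> 'a \<Rightarrow> 'a \<Rightarrow> 'a list \<Rightarrow> bool" where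
  "chain E p q xs \<longleftrightarrow>
     xs \<noteq> [] \<and> hd xs = p \<and> last xs = q \<and> successively (\<lambda>x y. (x, y) \<in> E) xs"

definition add_point :: "('a \<times> 'a) set \<Rightarrow> 'a \<Rightarrow> 'a \<Rightarrow> 'a list \<Rightarrow> 'a list \<Rightarrow> bool" where
  "add_point E p q xs ys \<longleftrightarrow>
     chain E p q xs \<and> chain E p q ys \<and> (\<exists>us v ws. xs = us @ ws \<and> ys = us @ v # ws)"

definition chain_homotopic :: "('a \<times> 'a) set \<Rightarrow> 'a list \<Rightarrow> 'a list \<Rightarrow> bool" where
  "chain_homotopic E xs ys \<longleftrightarrow> (\<exists>p q. chain E p q xs \<and> equivclp (add_point E p q) xs ys)"

definition chain_class :: "('a \<times> 'a) set \<Rightarrow> 'a list \<Rightarrow> 'a list set" where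
  "chain_class E xs = {ys. chain_homotopic E xs ys}"

definition chain_space :: "'a \<Rightarrow> ('a \<times> 'a) set \<Rightarrow> 'a list set set" where
  "chain_space b E = {chain_class E xs | xs q. chain E b q xs}"

definition endpoint :: "'a list set \<Rightarrow> 'a" where
  "endpoint C = (THE q. \<exists>xs\<in>C. last xs = q)"

definition entourage_lift ::
    "'a \<Rightarrow> ('a \<times> 'a) set \<Rightarrow> ('a \<times> 'a) set \<Rightarrow> ('a list set \<times> 'a list set) set" where
  "entourage_lift b E D =
     {(chain_class E (xs @ [y]), chain_class E (xs @ [z])) | xs y z.
        xs \<noteq> [] \<and> chain E b y (xs @ [y]) \<and> chain E b z (xs @ [z]) \<and> (y, z) \<in> D}"

definition chain_uniformity ::
    "'a::uniform_space \<Rightarrow> ('a \<times> 'a) set \<Rightarrow> ('a list set \<times> 'a list set) filter" where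
  "chain_uniformity b E =
     (INF D \<in> {D. entourage D \<and> D \<subseteq> E}. principal (entourage_lift b E D))"


section \<open>Uniform homeomorphisms and universality\<close>

text \<open>A uniform space with carrier \<open>A\<close> is given by a filter on pairs that contains \<open>A \<times> A\<close>,
  as the sets of classes \<open>chain_space b E\<close> vary with \<open>E\<close> and are not types.\<close>

definition uniform_homeomorphism ::
    "'a set \<Rightarrow> ('a \<times> 'a) filter \<Rightarrow> 'b set \<Rightarrow> ('b \<times> 'b) filter \<Rightarrow> ('a \<Rightarrow> 'b) \<Rightarrow> bool" where
  "uniform_homeomorphism A \<A> B \<B> f \<longleftrightarrow>
     bij_betw f A B \<and>
     filterlim (map_prod f f) \<B> \<A> \<and>
     filterlim (map_prod (inv_into A f) (inv_into A f)) \<A> \<B>"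

definition universal_space :: "'a::uniform_space \<Rightarrow> bool" where
  "universal_space b \<longleftrightarrow>
     (\<exists>\<U>. entourage_base \<U> \<and>
        (\<forall>E\<in>\<U>. uniform_homeomorphism (chain_space b E) (chain_uniformity b E)
                  (UNIV :: 'a set) uniformity endpoint))"


section \<open>Well-definedness of the constructions\<close>

lemma chain_homotopicD:
  assumes "chain_homotopic E xs ys" "chain E p q xs"
  shows "chain E p q ys"
proof -
  obtain p' q' where "chain E p' q' xs" and h: "equivclp (add_point E p' q') xs ys"
    using assms(1) by (auto simp: chain_homotopic_def)
  then have *: "p' = p" "q' = q" using assms(2) by (auto simp: chain_def)
  from h show ?thesis unfolding *
    by (induction rule: equivclp_induct) (use assms(2) in \<open>auto simp: add_point_def\<close>)
qed

lemma endpoint_chain_class: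
  assumes "chain E p q xs"
  shows "endpoint (chain_class E xs) = q"
  unfolding endpoint_def chain_class_def
proof (rule the_equality)
  have "chain_homotopic E xs xs" using assms by (auto simp: chain_homotopic_def)
  then show "\<exists>ys\<in>{ys. chain_homotopic E xs ys}. last ys = q"
    using assms by (auto simp: chain_def)
next
  show "r = q" if "\<exists>ys\<in>{ys. chain_homotopic E xs ys}. last ys = r" for r
    using that chain_homotopicD[OF _ assms] by (auto simp: chain_def)
qed

lemma entourage_Int: "entourage D \<Longrightarrow> entourage D' \<Longrightarrow> entourage (D \<inter> D')"
  by (auto simp: entourage_def sym_Int eventually_conj_iff)

lemma eventually_chain_uniformity:
  assumes "entourage E"
  shows "eventually P (chain_uniformity b E) \<longleftrightarrow>
           (\<exists>D. entourage D \<and> D \<subseteq> E \<and> (\<forall>c\<in>entourage_lift b E D. P c))"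
  unfolding chain_uniformity_def
proof (subst eventually_INF_base)
  fix D D' assume "D \<in> {D. entourage D \<and> D \<subseteq> E}" "D' \<in> {D. entourage D \<and> D \<subseteq> E}"
  then show "\<exists>x\<in>{D. entourage D \<and> D \<subseteq> E}. principal (entourage_lift b E x)
      \<le> inf (principal (entourage_lift b E D)) (principal (entourage_lift b E D'))"
    by (intro bexI[of _ "D \<inter> D'"])
       (auto simp: entourage_Int, auto simp: entourage_lift_def)
qed (use assms in \<open>auto simp: eventually_principal\<close>)

lemma entourage_lift_subset: "entourage_lift b E D \<subseteq> chain_space b E \<times> chain_space b E"
  by (auto simp: entourage_lift_def chain_space_def)

end

theory Submission
  imports Defs
begin

text \<open>The base witnessing universality consists of the entourages \<open>E\<close> all of whose balls are open and
  path connected. For such an \<open>E\<close> everything reduces to one fact: between the basepoint and any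
  point there is, up to \<open>E\<close>-homotopy, exactly one \<open>E\<close>-chain. The endpoint map is then bijective,
  and it carries the lift of \<open>D\<close> onto \<open>D\<close> itself: a pair \<open>(y, z)\<close> in \<open>D\<close> is the pair of endpoints of
  \<open>xs @ [y]\<close> and \<open>xs @ [z]\<close>, where \<open>xs\<close> is any chain to \<open>y\<close>. So the endpoint map and its inverse are
  uniformly continuous (\<open>endpoint_uniform_homeomorphism\<close>).

  Existence of chains holds because the set of points reachable from the basepoint and its complement
  are both unions of open balls (\<open>connected_imp_chain\<close>).

  For uniqueness it is enough that every chain that is a loop at \<open>p\<close> is homotopic to \<open>[p]\<close>
  (\<open>chain_homotopic_if_loops_trivial\<close>). Each link \<open>(x, y)\<close> of the loop can be replaced by a path from
  \<open>x\<close> to \<open>y\<close> inside the ball at \<open>x\<close>. All points of this path are adjacent to \<open>x\<close>, so a fine sample of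
  it can be contracted to the link; hence fine samples of the concatenated path \<open>g\<close> are homotopic to the
  given chain (\<open>chain_shadowed_by_path\<close>). By hypothesis \<open>g\<close> is null-homotopic. On a fine enough grid
  in the unit square, neighbouring grid points have \<open>E\<close>-close images under the homotopy, so consecutive
  rows of the grid are homotopic chains (\<open>chain_homotopic_parallel\<close>,
  \<open>samples_of_homotopic_paths\<close>), and the last row is constant.\<close>

section \<open>Calculus of chain homotopies\<close>

lemma entourage_refl: "entourage E \<Longrightarrow> (x, x) \<in> E"
  by (auto simp: entourage_def dest: uniformity_refl)

lemma entourage_symD: "entourage E \<Longrightarrow> (x, y) \<in> E \<Longrightarrow> (y, x) \<in> E"
  by (auto simp: entourage_def dest: symD)

lemma chain_homotopic_refl: "chain E p q xs \<Longrightarrow> chain_homotopic E xs xs"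
  by (auto simp: chain_homotopic_def)

lemma chain_homotopic_sym: "chain_homotopic E xs ys \<Longrightarrow> chain_homotopic E ys xs"
  using chain_homotopicD[of E xs ys] by (auto simp: chain_homotopic_def intro: equivclp_sym)

lemma chain_homotopic_trans [trans]:
  assumes "chain_homotopic E xs ys" "chain_homotopic E ys zs"
  shows "chain_homotopic E xs zs"
proof -
  obtain p q where xs: "chain E p q xs" and 1: "equivclp (add_point E p q) xs ys"
    using assms(1) by (auto simp: chain_homotopic_def)
  obtain p' q' where ys: "chain E p' q' ys" and 2: "equivclp (add_point E p' q') ys zs"
    using assms(2) by (auto simp: chain_homotopic_def)
  have "chain E p q ys" using chain_homotopicD[OF assms(1) xs] .
  with ys have "p' = p" "q' = q" by (auto simp: chain_def)
  with xs 1 2 show ?thesis by (auto simp: chain_homotopic_def intro: equivclp_trans)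
qed

lemma chain_homotopic_insert:
  assumes "chain E p q (us @ ws)" "chain E p q (us @ v # ws)"
  shows "chain_homotopic E (us @ ws) (us @ v # ws)"
proof -
  have "add_point E p q (us @ ws) (us @ v # ws)"
    using assms unfolding add_point_def by blast
  then show ?thesis
    using assms(1) unfolding chain_homotopic_def by (blast intro: r_into_equivclp)
qed

lemma chain_homotopic_remove:
  assumes "chain E p q (us @ v # ws)" "chain E p q (us @ ws)"
  shows "chain_homotopic E (us @ v # ws) (us @ ws)"
  by (rule chain_homotopic_sym, rule chain_homotopic_insert[OF assms(2,1)])

lemma chain_replace:
  assumes "chain E p q (us @ xs @ ws)" "chain E p' q' xs" "chain E p' q' ys"
  shows "chain E p q (us @ ys @ ws)"
  using assms
  by (auto simp: chain_def successively_append_iff hd_append last_append split: if_splits)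

text \<open>Homotopy is compatible with concatenation on both sides: each move inside \<open>xs\<close> is a move of the long
  chain, as the end points of \<open>xs\<close>, which carry the links to \<open>us\<close> and \<open>ws\<close>, stay fixed.\<close>

lemma chain_homotopic_context:
  assumes "chain_homotopic E xs ys" "chain E p q (us @ xs @ ws)"
  shows "chain_homotopic E (us @ xs @ ws) (us @ ys @ ws)"
proof -
  obtain p' q' where xs: "chain E p' q' xs" and h: "equivclp (add_point E p' q') xs ys"
    using assms(1) by (auto simp: chain_homotopic_def)
  have adding: "chain_homotopic E (us @ ys @ ws) (us @ zs @ ws)"
    if "add_point E p' q' ys zs" for ys zs
  proof -
    from that obtain as v bs where eq: "ys = as @ bs" "zs = as @ v # bs"
      and ch: "chain E p' q' ys" "chain E p' q' zs" by (auto simp: add_point_def)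
    have "chain E p q (us @ ys @ ws)" "chain E p q (us @ zs @ ws)"
      using chain_replace[OF assms(2) xs] ch by auto
    then show ?thesis
      using chain_homotopic_insert[of E p q "us @ as" "bs @ ws" v] by (simp add: eq)
  qed
  from h show ?thesis
  proof (induction rule: equivclp_induct)
    case base
    show ?case using chain_homotopic_refl[OF assms(2)] .
  next
    case (step y z)
    then have "chain_homotopic E (us @ y @ ws) (us @ z @ ws)"
      using adding chain_homotopic_sym by blast
    with step.IH show ?case by (rule chain_homotopic_trans)
  qed
qed

text \<open>Inside the ball at its first point a chain contracts to a single link: each point after \<open>x\<close> can be
  removed in turn, because \<open>x\<close> is adjacent to the point that follows it.\<close>

lemma chain_homotopic_cone:
  assumes "chain E x q (x # ys)" "ys \<noteq> []" "set ys \<subseteq> eball x E"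
  shows "chain_homotopic E (x # ys) [x, last ys]"
  using assms
proof (induction ys rule: induct_list012)
  case 1
  then show ?case by simp
next
  case (2 y)
  then show ?case by (auto intro: chain_homotopic_refl)
next
  case (3 y z ys)
  have ch: "chain E x q (x # z # ys)"
    using 3 by (auto simp: chain_def eball_def)
  then have "chain_homotopic E (x # z # ys) [x, last (z # ys)]"
    using 3 by auto
  moreover have "chain_homotopic E (x # y # z # ys) (x # z # ys)"
    using chain_homotopic_remove[of E x q "[x]" y "z # ys"] 3 ch by simp
  ultimately show ?case using chain_homotopic_trans by fastforce
qed

lemma chain_rev:
  assumes "entourage E" "chain E p q ys"
  shows "chain E q p (rev ys)"
proof -
  have "successively (\<lambda>x y. (y, x) \<in> E) ys"
    using assms(2) by (auto simp: chain_def intro: successively_mono entourage_symD[OF assms(1)])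
  then show ?thesis
    using assms(2) by (simp add: chain_def hd_rev last_rev)
qed

lemma chain_append:
  "chain E p q xs \<Longrightarrow> chain E q' r ys \<Longrightarrow> (q, q') \<in> E \<Longrightarrow> chain E p r (xs @ ys)"
  by (auto simp: chain_def successively_append_iff)

text \<open>Cancellation proceeds from the middle outwards; the two copies of the innermost point are removed
  one after the other.\<close>

lemma chain_homotopic_rev_cancel:
  assumes "entourage E" "chain E p q ys"
  shows "chain_homotopic E (rev ys @ ys) [q]"
  using assms(2)
proof (induction ys arbitrary: p rule: induct_list012)
  case 1
  then show ?case by (simp add: chain_def)
next
  case (2 x)
  then have "x = q" by (auto simp: chain_def)
  then show ?case
    using chain_homotopic_remove[of E q q "[q]" q "[]"] entourage_refl[OF assms(1)]
    by (simp add: chain_def \<open>x = q\<close>)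
next
  case (3 x y ys)
  let ?zs = "y # ys"
  have ch: "chain E y q ?zs" and xy: "(x, y) \<in> E" "(y, x) \<in> E"
    using 3 entourage_symD[OF assms(1)] by (auto simp: chain_def)
  have x: "chain E x x [x]" by (simp add: chain_def)
  note r = entourage_refl[OF assms(1)] and zs = chain_rev[OF assms(1) ch]
  have c: "chain E q q (rev ?zs @ [x] @ [x] @ ?zs)" "chain E q q (rev ?zs @ [x] @ ?zs)"
       "chain E q q (rev ?zs @ ?zs)"
    by (rule chain_append[OF zs] chain_append[OF x] x ch xy r)+
  have "chain_homotopic E (rev ?zs @ [x] @ [x] @ ?zs) (rev ?zs @ [x] @ ?zs)"
    using chain_homotopic_remove[of E q q "rev ?zs" x "[x] @ ?zs"] c by simp
  also have "chain_homotopic E (rev ?zs @ [x] @ ?zs) (rev ?zs @ ?zs)"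
    using chain_homotopic_remove[of E q q "rev ?zs" x ?zs] c by simp
  also have "chain_homotopic E (rev ?zs @ ?zs) [q]"
    using "3.IH"(2)[OF ch] .
  finally show ?case by simp
qed

text \<open>The usual argument for fundamental groups: \<open>xs\<close> is homotopic to \<open>xs @ rev ys @ ys\<close>, in which
  \<open>rev ys @ ys\<close> is trivial by cancellation and \<open>xs @ rev ys\<close> is trivial as a loop.\<close>

lemma chain_homotopic_if_loops_trivial:
  assumes E: "entourage E"
    and loops: "\<And>zs. chain E p p zs \<Longrightarrow> chain_homotopic E zs [p]"
    and xs: "chain E p q xs" and ys: "chain E p q ys"
  shows "chain_homotopic E xs ys"
proof -
  note r = entourage_refl[OF E]
  have single: "chain E a a [a]" for a by (simp add: chain_def)
  note sy = chain_rev[OF E ys]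
  have c: "chain E p q (xs @ rev ys @ ys)" "chain E p p (xs @ rev ys)" "chain E p q (xs @ [q])"
    "chain E p q ([p] @ ys)"
    by (rule chain_append[OF xs] chain_append[OF sy] chain_append[OF single] single ys sy r)+
  have "chain_homotopic E xs (xs @ [q])"
    using chain_homotopic_insert[of E p q xs "[]" q] xs c by simp
  also have "chain_homotopic E (xs @ [q]) (xs @ rev ys @ ys)"
    using chain_homotopic_context[OF chain_homotopic_rev_cancel[OF E ys], of p q xs "[]"] c
    by (auto intro: chain_homotopic_sym)
  also have "chain_homotopic E (xs @ rev ys @ ys) ([p] @ ys)"
    using chain_homotopic_context[OF loops[OF c(2)], of p q "[]" ys] c by simp
  also have "chain_homotopic E ([p] @ ys) ys"
    using chain_homotopic_remove[of E p q "[]" p ys] ys c by simp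
  finally show ?thesis .
qed

lemma chain_map_upt:
  "chain E (f 0) (f n) (map f [0..<Suc n]) \<longleftrightarrow> (\<forall>i<n. (f i, f (Suc i)) \<in> E)"
  by (auto simp: chain_def successively_conv_nth hd_map last_map simp del: upt_Suc)

text \<open>Two parallel chains form a ladder, triangulated by the diagonals from \<open>f i\<close> to \<open>g (Suc i)\<close>. The chain
  that follows \<open>f\<close> to the end and then crosses to \<open>g\<close> is pushed over the triangles, from the last rung
  to the first, until it crosses at the beginning.\<close>

lemma chain_homotopic_ladder:
  assumes f: "\<And>i. i < n \<Longrightarrow> (f i, f (Suc i)) \<in> E"
    and g: "\<And>i. i < n \<Longrightarrow> (g i, g (Suc i)) \<in> E"
    and fg: "\<And>i. i \<le> n \<Longrightarrow> (f i, g i) \<in> E"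
    and diag: "\<And>i. i < n \<Longrightarrow> (f i, g (Suc i)) \<in> E"
  shows "chain_homotopic E (map f [0..<Suc n] @ [g n]) (f 0 # map g [0..<Suc n])"
  using assms
proof (induction n)
  case 0
  then show ?case by (auto simp: chain_def intro: chain_homotopic_refl)
next
  case (Suc n)
  have IH: "chain_homotopic E (map f [0..<Suc n] @ [g n]) (f 0 # map g [0..<Suc n])"
    using Suc by auto
  let ?F = "map f [0..<Suc n]"
  have F: "chain E (f 0) (f n) ?F"
    using Suc.prems unfolding chain_map_upt by auto
  have tails: "chain E (f (Suc n)) (g (Suc n)) [f (Suc n), g (Suc n)]"
      "chain E (g (Suc n)) (g (Suc n)) [g (Suc n)]" "chain E (g n) (g (Suc n)) [g n, g (Suc n)]"
    using Suc.prems by (auto simp: chain_def)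
  have c: "chain E (f 0) (g (Suc n)) (?F @ f (Suc n) # [g (Suc n)])"
      "chain E (f 0) (g (Suc n)) (?F @ [g (Suc n)])"
      "chain E (f 0) (g (Suc n)) (?F @ g n # [g (Suc n)])"
    using Suc.prems tails[THEN chain_append[OF F]] by auto
  \<comment> \<open>The last square: first take its diagonal, then go around its other side.\<close>
  have "chain_homotopic E (?F @ f (Suc n) # [g (Suc n)]) (?F @ [g (Suc n)])"
    using chain_homotopic_remove c by fast
  also have "chain_homotopic E (?F @ [g (Suc n)]) (?F @ g n # [g (Suc n)])"
    using chain_homotopic_insert c by fast
  also have "chain_homotopic E (?F @ g n # [g (Suc n)]) ((f 0 # map g [0..<Suc n]) @ [g (Suc n)])"
    using chain_homotopic_context[OF IH, of "f 0" "g (Suc n)" "[]" "[g (Suc n)]"] c by simp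
  finally show ?case by simp
qed

lemma chain_homotopic_parallel:
  assumes f: "\<And>i. i < n \<Longrightarrow> (f i, f (Suc i)) \<in> E"
    and g: "\<And>i. i < n \<Longrightarrow> (g i, g (Suc i)) \<in> E"
    and fg: "\<And>i. i \<le> n \<Longrightarrow> (f i, g i) \<in> E"
    and diag: "\<And>i. i < n \<Longrightarrow> (f i, g (Suc i)) \<in> E"
    and ends: "f 0 = g 0" "f n = g n"
  shows "chain_homotopic E (map f [0..<Suc n]) (map g [0..<Suc n])"
proof -
  let ?F = "map f [0..<Suc n]" and ?G = "map g [0..<Suc n]"
  have F: "chain E (g 0) (g n) ?F"
    using chain_map_upt[of E f n] f ends by simp
  have G: "chain E (g 0) (g n) ?G"
    using chain_map_upt[of E g n] g by simp
  have r: "(g 0, g 0) \<in> E" "(g n, g n) \<in> E"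
    using fg[of 0] fg[of n] ends by auto
  have c: "chain E (g 0) (g n) (?F @ [g n])" "chain E (g 0) (g n) (g 0 # ?G)"
    using chain_append[OF F, of "g n" "g n" "[g n]"] chain_append[OF _ G, of "g 0" "g 0" "[g 0]"] r
    by (auto simp: chain_def)
  have "chain_homotopic E ?F (?F @ [g n])"
    using chain_homotopic_insert[of E "g 0" "g n" ?F "[]" "g n"] F c by simp
  also have "chain_homotopic E (?F @ [g n]) (g 0 # ?G)"
    using chain_homotopic_ladder[of n f E g] assms by metis
  also have "chain_homotopic E (g 0 # ?G) ?G"
    using chain_homotopic_remove[of E "g 0" "g n" "[]" "g 0" ?G] G c by simp
  finally show ?thesis .
qed


section \<open>Sampling paths\<close>

definition sample :: "nat \<Rightarrow> (real \<Rightarrow> 'a) \<Rightarrow> 'a list" where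
  "sample N g = map (\<lambda>i. g (real i / real N)) [0..<Suc N]"

lemma hd_sample: "hd (sample N g) = pathstart g"
  by (simp add: sample_def pathstart_def hd_map del: upt_Suc)

lemma last_sample: "N > 0 \<Longrightarrow> last (sample N g) = pathfinish g"
  by (simp add: sample_def pathfinish_def)

lemma sample_nonempty: "sample N g \<noteq> []"
  by (simp add: sample_def)

lemma chain_sample:
  "N > 0 \<Longrightarrow> chain E (pathstart g) (pathfinish g) (sample N g) \<longleftrightarrow>
     successively (\<lambda>x y. (x, y) \<in> E) (sample N g)"
  by (simp add: chain_def hd_sample last_sample sample_nonempty)

lemma set_sample: "set (sample N g) \<subseteq> path_image g"
  by (auto simp: sample_def path_image_def divide_le_eq simp del: upt_Suc intro!: imageI)

text \<open>The common end point of \<open>g\<close> and \<open>h\<close> is sampled only once, hence the \<open>tl\<close>.\<close>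

lemma sample_joinpaths:
  assumes "pathfinish g = pathstart h" "N > 0"
  shows "sample (2 * N) (g +++ h) = sample N g @ tl (sample N h)"
proof (rule nth_equalityI)
  show "length (sample (2 * N) (g +++ h)) = length (sample N g @ tl (sample N h))"
    by (simp add: sample_def)
next
  fix i assume "i < length (sample (2 * N) (g +++ h))"
  then have i: "i \<le> 2 * N" by (simp add: sample_def)
  show "sample (2 * N) (g +++ h) ! i = (sample N g @ tl (sample N h)) ! i"
  proof (cases "i \<le> N")
    case True
    then show ?thesis using assms i
      by (simp add: sample_def nth_append joinpaths_def del: upt_Suc)
  next
    case False
    then have "2 * (real i / (2 * real N)) - 1 = real (i - N) / real N"
      using assms i by (simp add: field_simps of_nat_diff)
    moreover have "\<not> real i / (2 * real N) \<le> 1 / 2"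
      using False assms by (simp add: field_simps)
    ultimately show ?thesis using False assms i
      by (simp add: sample_def nth_append nth_tl joinpaths_def Suc_diff_Suc del: upt_Suc)
  qed
qed

text \<open>Iterated joins run through the given points at dyadic times, so only samples whose number of
  steps is a multiple of a suitable \<open>k\<close> visit all of them; these are the samples considered. Fineness of a
  sample is expressed as its being an \<open>E\<close>-chain, a property that the samples of the two halves of a join
  inherit. Taking the path for a link inside the ball at its first point is what allows
  \<open>chain_homotopic_cone\<close> to contract its sample.\<close>

lemma chain_shadowed_by_path:
  assumes E: "\<And>x. (x, x) \<in> E"
    and pc: "\<And>x. path_connected (eball x E)"
    and "chain E p q xs"
  shows "\<exists>g k. path g \<and> pathstart g = p \<and> pathfinish g = q \<and> k > 0 \<and>
    (\<forall>M>0. successively (\<lambda>x y. (x, y) \<in> E) (sample (k * M) g) \<longrightarrow>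
       chain_homotopic E (sample (k * M) g) xs)"
  using assms(3)
proof (induction xs arbitrary: p rule: induct_list012)
  case 1
  then show ?case by (simp add: chain_def)
next
  case (2 x)
  then have pq: "p = x" "q = x" by (auto simp: chain_def)
  have "chain_homotopic E (sample (1 * M) (\<lambda>_. x)) [x]" if "M > 0" for M
  proof -
    have s: "sample M (\<lambda>_::real. x) = replicate (Suc M) x"
      by (simp add: sample_def map_replicate_const del: upt_Suc replicate_Suc)
    have "chain E x x (x # replicate M x)"
      using E by (simp add: chain_def successively_conv_nth nth_Cons' last_replicate)
    then have "chain_homotopic E (x # replicate M x) [x, last (replicate M x)]"
      using that E by (intro chain_homotopic_cone) (auto simp: eball_def)
    moreover have "chain_homotopic E [x, x] [x]"
      using chain_homotopic_remove[of E x x "[x]" x "[]"] E by (simp add: chain_def)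
    ultimately show ?thesis using that s chain_homotopic_trans by fastforce
  qed
  then show ?case
    by (intro exI[of _ "\<lambda>_. x"] exI[of _ 1]) (auto simp: pq path_def pathstart_def pathfinish_def)
next
  case (3 x y ys)
  \<comment> \<open>A path \<open>r\<close> for the first link, joined to a path \<open>h\<close> for the remaining chain.\<close>
  have px: "p = x" and xy: "(x, y) \<in> E" and ch: "chain E y q (y # ys)"
    using 3 by (auto simp: chain_def)
  obtain h k where h: "path h" "pathstart h = y" "pathfinish h = q" "k > 0"
    and hk: "\<And>M. M > 0 \<Longrightarrow> successively (\<lambda>x y. (x, y) \<in> E) (sample (k * M) h) \<Longrightarrow>
       chain_homotopic E (sample (k * M) h) (y # ys)"
    using "3.IH"(2)[OF ch] by blast
  obtain r where r: "path r" "path_image r \<subseteq> eball x E" "pathstart r = x" "pathfinish r = y"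
    using pc[of x] E[of x] xy unfolding path_connected_def eball_def by blast
  have "chain_homotopic E (sample (2 * k * M) (r +++ h)) (x # y # ys)"
    if M: "M > 0" and "successively (\<lambda>x y. (x, y) \<in> E) (sample (2 * k * M) (r +++ h))" for M
  proof -
    let ?N = "k * M"
    let ?R = "sample ?N r" and ?H = "sample ?N h"
    have N: "?N > 0" using M h by simp
    have eq: "sample (2 * k * M) (r +++ h) = ?R @ tl ?H"
      using sample_joinpaths[of r h ?N] r h N by (simp add: mult.assoc)
    have sRH: "successively (\<lambda>x y. (x, y) \<in> E) (?R @ tl ?H)" using that eq by simp
    have Hc: "?H = y # tl ?H"
      using hd_sample[of ?N h] sample_nonempty[of ?N h] h by (metis list.collapse)
    have Rc: "?R = x # tl ?R"
      using hd_sample[of ?N r] sample_nonempty[of ?N r] r by (metis list.collapse)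
    have lR: "last ?R = y" using last_sample[OF N] r by metis
    have lH: "last ?H = q" using last_sample[OF N] h by metis
    have sR: "successively (\<lambda>x y. (x, y) \<in> E) ?R"
      using sRH by (simp add: successively_append_iff)
    have "successively (\<lambda>x y. (x, y) \<in> E) (y # tl ?H)"
      using sRH lR sample_nonempty[of ?N r] by (auto simp: successively_append_iff successively_Cons)
    then have sH: "successively (\<lambda>x y. (x, y) \<in> E) ?H" using Hc by simp
    have cR: "chain E x y ?R" using chain_sample[OF N, of E r] sR r by simp
    have tlR: "tl ?R \<noteq> []" using N by (simp add: sample_def)
    have "set (tl ?R) \<subseteq> eball x E"
      using set_sample[of ?N r] r(2) by (auto dest: list.set_sel(2)[OF sample_nonempty])
    then have "chain_homotopic E (x # tl ?R) [x, last (tl ?R)]"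
      using cR Rc tlR by (intro chain_homotopic_cone) auto
    then have R: "chain_homotopic E ?R [x, y]"
      using Rc lR tlR by (metis last_ConsR)
    have cRH: "chain E x q (?R @ tl ?H)"
    proof -
      have "last (?R @ tl ?H) = q"
        using lR lH Hc by (metis append_Nil2 last_ConsL last_ConsR last_append)
      moreover have "hd (?R @ tl ?H) = x" using Rc by (metis hd_append2 list.sel(1) list.distinct(1))
      ultimately show ?thesis using sRH sample_nonempty[of ?N r] by (simp add: chain_def)
    qed
    have "chain_homotopic E (?R @ tl ?H) ([x, y] @ tl ?H)"
      using chain_homotopic_context[OF R, of x q "[]" "tl ?H"] cRH by simp
    also have "[x, y] @ tl ?H = [x] @ ?H @ []" using Hc by simp
    also have "chain_homotopic E ([x] @ ?H @ []) ([x] @ (y # ys) @ [])"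
    proof (rule chain_homotopic_context)
      show "chain_homotopic E ?H (y # ys)" using hk[OF M sH] .
      show "chain E x q ([x] @ ?H @ [])"
        using sH lH Hc xy sample_nonempty[of ?N h] hd_sample[of ?N h] h
        by (simp add: chain_def successively_Cons)
    qed
    finally show ?thesis using eq by simp
  qed
  then show ?case
    using r h by (intro exI[of _ "r +++ h"] exI[of _ "2 * k"]) (auto simp: px)
qed


section \<open>Chains in simply connected spaces\<close>

text \<open>Uniform continuity on compact sets, for maps from a metric space to a uniform space. If \<open>D\<close> composed
  with itself lies in \<open>E\<close>, then points with \<open>D\<close>-close image to a common \<open>f x\<close> have \<open>E\<close>-close images, and
  a Lebesgue number of the resulting open cover is a valid \<open>\<delta>\<close>.\<close>

lemma compact_entourage_Lebesgue_number:
  fixes f :: "'a::metric_space \<Rightarrow> 'b::uniform_space"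
  assumes S: "compact S" and f: "continuous_on S f" and E: "entourage E"
  obtains \<delta> where "\<delta> > 0" "\<And>u v. u \<in> S \<Longrightarrow> v \<in> S \<Longrightarrow> dist u v < \<delta> \<Longrightarrow> (f u, f v) \<in> E"
proof -
  have "eventually (\<lambda>p. p \<in> E) uniformity" using E by (simp add: entourage_def)
  then obtain D where D: "eventually D uniformity"
    and DD: "\<And>x y z. D (x, y) \<Longrightarrow> D (y, z) \<Longrightarrow> (x, z) \<in> E"
    using uniformity_trans by blast
  \<comment> \<open>\<open>D\<close> may be asymmetric, but going from \<open>f u\<close> to \<open>f v\<close> via \<open>f x\<close> uses both directions.\<close>
  define W where "W = (\<lambda>p. D p \<and> (case p of (x, y) \<Rightarrow> D (y, x)))"
  have W: "eventually W uniformity"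
    using D uniformity_sym[OF D] unfolding W_def by (rule eventually_conj)
  have "\<exists>A. open A \<and> x \<in> A \<and> (\<forall>y\<in>A \<inter> S. W (f x, f y))" if "x \<in> S" for x
  proof -
    have "eventually (\<lambda>y. W (f x, y)) (nhds (f x))"
      unfolding eventually_nhds_uniformity by (rule eventually_mono[OF W]) auto
    then obtain U where U: "open U" "f x \<in> U" "\<And>y. y \<in> U \<Longrightarrow> W (f x, y)"
      by (auto simp: eventually_nhds)
    obtain A where "open A" "A \<inter> S = f -` U \<inter> S"
      using f U(1) unfolding continuous_on_open_invariant by blast
    then show ?thesis using U that by blast
  qed
  then obtain A where A: "\<And>x. x \<in> S \<Longrightarrow> open (A x) \<and> x \<in> A x \<and> (\<forall>y\<in>A x \<inter> S. W (f x, f y))"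
    by metis
  obtain \<delta> where \<delta>: "\<delta> > 0" "\<And>u. u \<in> S \<Longrightarrow> \<exists>G\<in>A ` S. ball u \<delta> \<subseteq> G"
    by (rule Heine_Borel_lemma[OF S, of "A ` S"]) (use A in blast)+
  show ?thesis
  proof (rule that[OF \<delta>(1)])
    fix u v assume uv: "u \<in> S" "v \<in> S" "dist u v < \<delta>"
    obtain x where x: "x \<in> S" "ball u \<delta> \<subseteq> A x" using \<delta>(2)[OF uv(1)] by blast
    have "u \<in> A x" "v \<in> A x" using x uv \<delta>(1) by auto
    then have "W (f x, f u)" "W (f x, f v)" using A[OF x(1)] uv by auto
    then show "(f u, f v) \<in> E" using DD unfolding W_def by auto
  qed
qed

text \<open>The homotopy is restricted to an \<open>N\<close> by \<open>N\<close> grid, where \<open>N\<close> is so large that the corners of each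
  grid square have \<open>E\<close>-close images; then consecutive rows are parallel chains with common end points.\<close>

lemma samples_of_homotopic_paths:
  fixes g h :: "real \<Rightarrow> 'a::uniform_space"
  assumes E: "entourage E" and gh: "homotopic_paths UNIV g h"
  obtains N0 where "\<And>N. N \<ge> N0 \<Longrightarrow> N > 0 \<and>
     chain E (pathstart g) (pathfinish g) (sample N g) \<and>
     chain_homotopic E (sample N g) (sample N h)"
proof -
  let ?I = "{0..1::real}"
  obtain H where H: "continuous_on (?I \<times> ?I) H"
    and H0: "\<And>x. x \<in> ?I \<Longrightarrow> H (0, x) = g x" and H1: "\<And>x. x \<in> ?I \<Longrightarrow> H (1, x) = h x"
    and ends: "\<And>t. t \<in> ?I \<Longrightarrow> H (t, 0) = pathstart g \<and> H (t, 1) = pathfinish g"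
    using gh unfolding homotopic_paths by (auto simp: pathstart_def pathfinish_def)
  have "compact (?I \<times> ?I)" by (intro compact_Times) auto
  then obtain \<delta> where \<delta>: "\<delta> > 0"
    and close: "\<And>u v. u \<in> ?I \<times> ?I \<Longrightarrow> v \<in> ?I \<times> ?I \<Longrightarrow> dist u v < \<delta> \<Longrightarrow> (H u, H v) \<in> E"
    using compact_entourage_Lebesgue_number[OF _ H E] by blast
  \<comment> \<open>Corners of a grid square have distance at most \<open>2 / N\<close>, the sum of its side lengths.\<close>
  obtain N0 :: nat where N0: "2 / \<delta> < real N0" using reals_Archimedean2 by blast
  show ?thesis
  proof (rule that)
    fix N assume "N \<ge> N0"
    then have N\<delta>: "2 / \<delta> < real N" using N0 by simp
    then have N: "N > 0" using \<delta> by (smt (verit) divide_pos_pos of_nat_0_less_iff)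
    have mesh: "2 / real N < \<delta>" using N\<delta> N \<delta> by (simp add: field_simps)
    define G where "G j i = H (real j / real N, real i / real N)" for j i
    have grid: "(G j i, G j' i') \<in> E"
      if "j \<le> N" "j' \<le> N" "i \<le> N" "i' \<le> N" "j' \<in> {j, Suc j}" "i' \<in> {i, Suc i}" for j j' i i'
    proof -
      let ?u = "(real j / real N, real i / real N)" and ?v = "(real j' / real N, real i' / real N)"
      have "dist (real j / real N) (real j' / real N) \<le> 1 / real N"
           "dist (real i / real N) (real i' / real N) \<le> 1 / real N"
        using that N by (auto simp: dist_real_def field_simps)
      then have "dist ?u ?v \<le> 2 / real N"
        unfolding dist_Pair_Pair
        by (intro order.trans[OF sqrt_sum_squares_le_sum]) auto
      then show ?thesis unfolding G_def
        using mesh that N by (intro close) auto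
    qed
    have sides: "G j 0 = pathstart g" "G j N = pathfinish g" if "j \<le> N" for j
      using ends[of "real j / real N"] that N by (auto simp: G_def)
    have row: "chain_homotopic E (map (G 0) [0..<Suc N]) (map (G j) [0..<Suc N])" if "j \<le> N" for j
      using that
    proof (induction j)
      case 0
      have "chain E (G 0 0) (G 0 N) (map (G 0) [0..<Suc N])"
        unfolding chain_map_upt using grid by auto
      then show ?case by (rule chain_homotopic_refl)
    next
      case (Suc j)
      have "chain_homotopic E (map (G j) [0..<Suc N]) (map (G (Suc j)) [0..<Suc N])"
        by (rule chain_homotopic_parallel) (use Suc.prems grid sides in \<open>auto simp del: of_nat_Suc\<close>)
      with Suc show ?case using chain_homotopic_trans by auto
    qed
    have s: "sample N g = map (G 0) [0..<Suc N]" "sample N h = map (G N) [0..<Suc N]"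
      using N by (auto simp: sample_def G_def H0 H1)
    have "chain E (G 0 0) (G 0 N) (map (G 0) [0..<Suc N])"
      unfolding chain_map_upt using grid by auto
    then show "N > 0 \<and> chain E (pathstart g) (pathfinish g) (sample N g) \<and>
       chain_homotopic E (sample N g) (sample N h)"
      using row[of N] N ends[of 0] s by (simp add: G_def)
  qed
qed

text \<open>The loop is a fine sample of a shadowing path up to homotopy, and a contraction of that path
  turns the sample into a constant chain.\<close>

lemma chain_loop_null_homotopic:
  fixes E :: "('a::uniform_space \<times> 'a) set"
  assumes E: "entourage E" and pc: "\<And>x. path_connected (eball x E)"
    and loops: "loops_null_homotopic TYPE('a)" and xs: "chain E p p xs"
  shows "chain_homotopic E xs [p]"
proof -
  note r = entourage_refl[OF E]
  obtain g k where g: "path g" "pathstart g = p" "pathfinish g = p" and k: "k > 0"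
    and gk: "\<And>M. M > 0 \<Longrightarrow> successively (\<lambda>x y. (x, y) \<in> E) (sample (k * M) g) \<Longrightarrow>
       chain_homotopic E (sample (k * M) g) xs"
    using chain_shadowed_by_path[OF r pc xs] by blast
  have "homotopic_paths UNIV g (\<lambda>_. p)"
    using loops g unfolding loops_null_homotopic_def by metis
  then obtain N0 where N0: "\<And>N. N \<ge> N0 \<Longrightarrow> N > 0 \<and> chain E p p (sample N g) \<and>
      chain_homotopic E (sample N g) (sample N (\<lambda>_. p))"
    using samples_of_homotopic_paths[OF E, of g "\<lambda>_. p"] g by metis
  \<comment> \<open>\<open>k * M\<close> has the divisibility required by shadowing and the size required by the grid.\<close>
  define M where "M = Suc N0"
  have M: "M > 0" "k * M \<ge> N0" using k by (auto simp: M_def trans_le_add2 Suc_leI)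
  note N = N0[OF M(2)]
  have s: "sample (k * M) (\<lambda>_::real. p) = p # replicate (k * M) p"
    by (simp add: sample_def map_replicate_const del: upt_Suc flip: replicate_Suc)
  have "chain_homotopic E xs (sample (k * M) g)"
    using gk[OF M(1)] N by (auto simp: chain_def intro: chain_homotopic_sym)
  also have "chain_homotopic E (sample (k * M) g) (p # replicate (k * M) p)"
    using N s by simp
  also have "chain_homotopic E (p # replicate (k * M) p) [p, p]"
    using chain_homotopic_cone[of E p p "replicate (k * M) p"] N chain_homotopicD[of E] s r
    by (auto simp: eball_def)
  also have "chain_homotopic E [p, p] [p]"
    using chain_homotopic_remove[of E p p "[p]" p "[]"] r by (simp add: chain_def)
  finally show ?thesis .
qed

text \<open>Reachability by \<open>E\<close>-chains is preserved under passing to \<open>E\<close>-neighbours, and by symmetry of \<open>E\<close> so is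
  unreachability. Both sets are therefore unions of open balls, and connectedness makes one of them empty.\<close>

lemma connected_imp_chain:
  fixes E :: "('a::uniform_space \<times> 'a) set"
  assumes E: "entourage E" and op: "\<And>x. open (eball x E)" and conn: "connected (UNIV :: 'a set)"
  shows "\<exists>xs. chain E p q xs"
proof -
  define R where "R = {q. \<exists>xs. chain E p q xs}"
  have step: "z \<in> R" if "y \<in> R" "(y, z) \<in> E" for y z
  proof -
    from that obtain xs where "chain E p y xs" by (auto simp: R_def)
    with that have "chain E p z (xs @ [z])" by (auto simp: chain_def successively_append_iff)
    then show ?thesis by (auto simp: R_def)
  qed
  have "R = (\<Union>y\<in>R. eball y E)" "- R = (\<Union>y\<in>-R. eball y E)"
    using step entourage_refl[OF E] entourage_symD[OF E] by (fastforce simp: eball_def)+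
  then have "open R" "open (- R)" using op by (metis open_UN)+
  moreover have "p \<in> R" unfolding R_def by (auto simp: chain_def intro: exI[of _ "[p]"])
  ultimately have "R = UNIV"
    using connectedD[OF conn, of R "- R"] by auto
  then show ?thesis by (auto simp: R_def)
qed


section \<open>Universality\<close>

text \<open>Existence and uniqueness of chain classes give bijectivity. Since elements of \<open>entourage_lift b E D\<close>
  are pairs of classes of chains that differ only in their last point, the endpoint map identifies this lift with \<open>D\<close>;
  this gives uniform continuity in both directions.\<close>

lemma endpoint_uniform_homeomorphism:
  fixes b :: "'a::uniform_space"
  assumes E: "entourage E"
    and ex: "\<And>q. \<exists>xs. chain E b q xs"
    and un: "\<And>q xs ys. chain E b q xs \<Longrightarrow> chain E b q ys \<Longrightarrow> chain_homotopic E xs ys"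
  shows "uniform_homeomorphism (chain_space b E) (chain_uniformity b E)
           (UNIV :: 'a set) uniformity endpoint"
proof -
  have cls: "chain_class E xs = chain_class E ys" if "chain E b q xs" "chain E b q ys" for xs ys q
    using chain_homotopic_trans[OF un[OF that]]
      chain_homotopic_trans[OF chain_homotopic_sym[OF un[OF that]]]
    by (auto simp: chain_class_def)
  have inj: "inj_on endpoint (chain_space b E)"
  proof (rule inj_onI)
    fix C C' assume "C \<in> chain_space b E" "C' \<in> chain_space b E" and eq: "endpoint C = endpoint C'"
    then obtain xs q ys r where C: "C = chain_class E xs" "C' = chain_class E ys"
      and ch: "chain E b q xs" "chain E b r ys"
      unfolding chain_space_def by blast
    have "q = r"
      using eq unfolding C endpoint_chain_class[OF ch(1)] endpoint_chain_class[OF ch(2)] .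
    then show "C = C'" using cls ch C by blast
  qed
  have "q \<in> endpoint ` chain_space b E" for q
  proof -
    obtain xs where "chain E b q xs" using ex by blast
    then show ?thesis
      using endpoint_chain_class[of E b q xs] unfolding chain_space_def by blast
  qed
  then have bij: "bij_betw endpoint (chain_space b E) UNIV"
    using inj by (auto simp: bij_betw_def)
  have inv: "inv_into (chain_space b E) endpoint q = chain_class E xs" if "chain E b q xs" for q xs
  proof -
    have "chain_class E xs \<in> chain_space b E" using that unfolding chain_space_def by blast
    from inv_into_f_f[OF inj this] show ?thesis unfolding endpoint_chain_class[OF that] .
  qed
  have "filterlim (map_prod endpoint endpoint) uniformity (chain_uniformity b E)"
    unfolding filterlim_iff
  proof (intro allI impI)
    fix P :: "'a \<times> 'a \<Rightarrow> bool" assume P: "eventually P uniformity"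
    \<comment> \<open>The symmetric part of \<open>P\<close>, cut down to \<open>E\<close> to be admissible as an entourage to lift.\<close>
    define D where "D = E \<inter> {(x, y). P (x, y) \<and> P (y, x)}"
    have "entourage D"
      using E P uniformity_sym[OF P] unfolding D_def entourage_def
      by (auto simp: sym_def eventually_conj_iff case_prod_unfold)
    moreover have "P (map_prod endpoint endpoint c)" if "c \<in> entourage_lift b E D" for c
      using that by (auto simp: entourage_lift_def endpoint_chain_class D_def)
    ultimately show "eventually (\<lambda>c. P (map_prod endpoint endpoint c)) (chain_uniformity b E)"
      unfolding eventually_chain_uniformity[OF E] by (intro exI[of _ D]) (auto simp: D_def)
  qed
  moreover have "filterlim (map_prod (inv_into (chain_space b E) endpoint)
      (inv_into (chain_space b E) endpoint)) (chain_uniformity b E) uniformity"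
    unfolding filterlim_iff
  proof (intro allI impI)
    fix P assume "eventually P (chain_uniformity b E)"
    then obtain D where D: "entourage D" "D \<subseteq> E" and P: "\<And>c. c \<in> entourage_lift b E D \<Longrightarrow> P c"
      unfolding eventually_chain_uniformity[OF E] by blast
    have "P (map_prod (inv_into (chain_space b E) endpoint) (inv_into (chain_space b E) endpoint) (y, z))"
      if yz: "(y, z) \<in> D" for y z
    proof -
      obtain xs where xs: "chain E b y xs" using ex by blast
      have ch: "xs \<noteq> []" "chain E b y (xs @ [y])" "chain E b z (xs @ [z])"
        using xs yz D(2) entourage_refl[OF E] by (auto simp: chain_def successively_append_iff)
      then have "(chain_class E (xs @ [y]), chain_class E (xs @ [z])) \<in> entourage_lift b E D"
        using yz unfolding entourage_lift_def by blast
      then show ?thesis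
        using P inv[OF ch(2)] inv[OF ch(3)] by simp
    qed
    then show "eventually (\<lambda>p. P (map_prod (inv_into (chain_space b E) endpoint)
        (inv_into (chain_space b E) endpoint) p)) uniformity"
      using D(1) unfolding entourage_def by (auto elim!: eventually_mono)
  qed
  ultimately show ?thesis using bij by (simp add: uniform_homeomorphism_def)
qed

theorem theorem70:
  fixes b :: "'a::uniform_space"
  assumes "uniformly_locally_path_connected TYPE('a)"
    and "connected (UNIV :: 'a set)"
    and "loops_null_homotopic TYPE('a)"
  shows "universal_space b"
proof -
  define \<U> where "\<U> = {E :: ('a \<times> 'a) set. entourage E \<and>
    (\<forall>x. open (eball x E) \<and> path_connected (eball x E))}"
  have "entourage_base \<U>"
    using assms(1) unfolding entourage_base_def uniformly_locally_path_connected_def \<U>_def by blast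
  moreover have "uniform_homeomorphism (chain_space b E) (chain_uniformity b E)
      (UNIV :: 'a set) uniformity endpoint" if "E \<in> \<U>" for E
  proof (rule endpoint_uniform_homeomorphism)
    show E: "entourage E" using that by (simp add: \<U>_def)
    have op: "open (eball x E)" and pc: "path_connected (eball x E)" for x
      using that by (auto simp: \<U>_def)
    show "\<exists>xs. chain E b q xs" for q
      using connected_imp_chain[OF E op assms(2)] .
    show "chain_homotopic E xs ys" if "chain E b q xs" "chain E b q ys" for q xs ys
      using chain_homotopic_if_loops_trivial[OF E _ that]
        chain_loop_null_homotopic[OF E pc assms(3)] by blast
  qed
  ultimately show ?thesis unfolding universal_space_def by blast
qed

end
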